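(* Let $\mathbf{k}$ be a field of characteristic $0$ and let $(A,\mu,\alpha)$ be a multiplicative Hom-algebra over $\mathbf{k}$. Then the following statements are equivalent. (1) $A$ satisfies $x^2\alpha(x) = \alpha(x)x^2$ and $x^4 = \alpha(x^2)\alpha(x^2)$ for all $x \in A$. (2) $A$ satisfies $as_A(x,x,x) = 0 = as_A(x^2,\alpha(x),\alpha(x))$ for all $x \in A$. (3) $A$ is up to fourth Hom-power associative. (4) $A$ is Hom-power associative.
   Context: A Hom-algebra $(A,\mu,\alpha)$ over $\mathbf{k}$ is a $\mathbf{k}$-vector space $A$ with a bilinear map $\mu\colon A^{\otimes 2}\to A$ (no associativity assumed; write $xy=\mu(x,y)$) and a linear map $\alpha\colon A\to A$. It is multiplicative if $\alpha(xy)=\alpha(x)\alpha(y)$ for all $x,y$. Here $\alpha^n$ is the $n$-fold composition, $\alpha^0=Id$. Hom-powers: $x^1=x$ and $x^n=x^{n-1}\alpha^{n-2}(x)$ for $n\ge 2$ (so $x^2=xx$, $x^3=(xx)\alpha(x)$, $x^4=((xx)\alpha(x))\alpha^2(x)$). $A$ is $n$th Hom-power associative if $x^n=\alpha^{n-i-1}(x^i)\,\alpha^{i-1}(x^{n-i})$ for all $x\in A$ and $i\in\{1,\dots,n-1\}$. It is up to $n$th Hom-power associative if it is $k$th Hom-power associative for all $k\in\{2,\dots,n\}$, and Hom-power associative if it is $n$th Hom-power associative for all $n\ge 2$. The Hom-associator is $as_A(x,y,z)=(xy)\alpha(z)-\alpha(x)(yz)$. *)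

theory Defs
  imports Main "HOL.Vector_Spaces"
begin

(* The carrier is the whole type 'a; scale is the action of the field 'k on it. *)
locale hom_algebra = vector_space scale
  for scale :: "'k::field \<Rightarrow> 'a::ab_group_add \<Rightarrow> 'a" +
  fixes \<mu> :: "'a \<Rightarrow> 'a \<Rightarrow> 'a" and \<alpha> :: "'a \<Rightarrow> 'a"
  assumes linear_mult_right: "Vector_Spaces.linear scale scale (\<lambda>y. \<mu> x y)"
    and linear_mult_left: "Vector_Spaces.linear scale scale (\<lambda>x. \<mu> x y)"
    and linear_twist: "Vector_Spaces.linear scale scale \<alpha>"

locale multiplicative_hom_algebra = hom_algebra scale \<mu> \<alpha>
  for scale :: "'k::field \<Rightarrow> 'a::ab_group_add \<Rightarrow> 'a"
    and \<mu> :: "'a \<Rightarrow> 'a \<Rightarrow> 'a" and \<alpha> :: "'a \<Rightarrow> 'a" +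
  assumes twist_mult: "\<alpha> (\<mu> x y) = \<mu> (\<alpha> x) (\<alpha> y)"

(* Hom-powers start at exponent 1; the value at 0 is a dummy. *)
fun hom_pow :: "('a::zero \<Rightarrow> 'a \<Rightarrow> 'a) \<Rightarrow> ('a \<Rightarrow> 'a) \<Rightarrow> 'a \<Rightarrow> nat \<Rightarrow> 'a" where
  "hom_pow \<mu> \<alpha> x 0 = 0"
| "hom_pow \<mu> \<alpha> x (Suc 0) = x"
| "hom_pow \<mu> \<alpha> x (Suc (Suc n)) = \<mu> (hom_pow \<mu> \<alpha> x (Suc n)) ((\<alpha> ^^ n) x)"

lemma hom_pow_rec:
  assumes "n \<ge> 2"
  shows "hom_pow \<mu> \<alpha> x n = \<mu> (hom_pow \<mu> \<alpha> x (n - 1)) ((\<alpha> ^^ (n - 2)) x)"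
proof -
  obtain m where "n = Suc (Suc m)"
    using assms by (metis add_2_eq_Suc le_Suc_ex)
  then show ?thesis by simp
qed

definition nth_hom_power_assoc ::
    "('a::zero \<Rightarrow> 'a \<Rightarrow> 'a) \<Rightarrow> ('a \<Rightarrow> 'a) \<Rightarrow> nat \<Rightarrow> bool" where
  "nth_hom_power_assoc \<mu> \<alpha> n \<longleftrightarrow>
    (\<forall>x. \<forall>i\<in>{1..n - 1}.
      hom_pow \<mu> \<alpha> x n =
        \<mu> ((\<alpha> ^^ (n - i - 1)) (hom_pow \<mu> \<alpha> x i))
          ((\<alpha> ^^ (i - 1)) (hom_pow \<mu> \<alpha> x (n - i))))"

definition up_to_nth_hom_power_assoc ::
    "('a::zero \<Rightarrow> 'a \<Rightarrow> 'a) \<Rightarrow> ('a \<Rightarrow> 'a) \<Rightarrow> nat \<Rightarrow> bool" where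
  "up_to_nth_hom_power_assoc \<mu> \<alpha> n \<longleftrightarrow> (\<forall>k\<in>{2..n}. nth_hom_power_assoc \<mu> \<alpha> k)"

definition hom_power_assoc ::
    "('a::zero \<Rightarrow> 'a \<Rightarrow> 'a) \<Rightarrow> ('a \<Rightarrow> 'a) \<Rightarrow> bool" where
  "hom_power_assoc \<mu> \<alpha> \<longleftrightarrow> (\<forall>n\<ge>2. nth_hom_power_assoc \<mu> \<alpha> n)"

definition hom_associator ::
    "('a::ab_group_add \<Rightarrow> 'a \<Rightarrow> 'a) \<Rightarrow> ('a \<Rightarrow> 'a) \<Rightarrow> 'a \<Rightarrow> 'a \<Rightarrow> 'a \<Rightarrow> 'a" where
  "hom_associator \<mu> \<alpha> x y z = \<mu> (\<mu> x y) (\<alpha> z) - \<mu> (\<alpha> x) (\<mu> y z)"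

end

theory Submission
  imports Defs
begin

text \<open>
  Conditions (1), (2) and (3) differ only by unfolding definitions and multiplicativity of \<open>\<alpha>\<close>, except that (3) also asks for
  \<open>x\<^sup>4 = \<alpha>\<^sup>2(x) x\<^sup>3\<close>. That identity and all the higher ones come from (1), by a twisted version of
  Albert's argument for power-associative algebras in characteristic \<open>0\<close>.

  Write \<open>x\<^sup>a * x\<^sup>b\<close> for the twisted product \<open>\<alpha>\<^bsup>b-1\<^esup>(x\<^sup>a) \<alpha>\<^bsup>a-1\<^esup>(x\<^sup>b)\<close>, the one that occurs in the definition of
  Hom-power associativity. The claim is \<open>x\<^sup>a * x\<^sup>b = x\<^bsup>a+b\<^esup>\<close>, by strong induction on \<open>n = a + b\<close>. The two
  identities in (1) are polarised (lemmas \<open>polarise3\<close> and \<open>polarise4\<close>) and then evaluated at twisted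
  powers of \<open>x\<close> with total exponent \<open>n\<close>, where the induction hypothesis evaluates every inner
  product. What remains are linear relations among the products \<open>x\<^sup>a * x\<^sup>b\<close> of degree \<open>n\<close>.

  \<^item> The cubic identity says that \<open>f(a) = x\<^bsup>n-a\<^esup> * x\<^sup>a - x\<^sup>a * x\<^bsup>n-a\<^esup>\<close> satisfies \<open>f(a) + f(b) + f(c) = 0\<close> for
    \<open>a + b + c = n\<close>. As \<open>f(n - a) = - f(a)\<close>, this makes \<open>f\<close> additive, so \<open>f(a) = a f(1)\<close> and
    \<open>n f(1) = f(1) + f(n - 1) = 0\<close>. Hence powers commute in degree \<open>n\<close>
    (lemma \<open>cyclic_relation_antisymmetric_0\<close>).
  \<^item> By commutativity, \<open>g(a) = x\<^bsup>n-a\<^esup> * x\<^sup>a\<close> satisfies \<open>g(n - a) = g(a)\<close>, and the quartic identity becomes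
    \<open>3 (2 g(1) + g(b) + g(c)) = 4 (g(2) + g(b + 1) + g(c + 1))\<close> for \<open>b + c + 2 = n\<close>. This recurrence
    makes \<open>g(b) - g(1)\<close> a positive rational multiple of \<open>g(2) - g(1)\<close> for \<open>1 < b < n\<close>. The difference is zero
    at \<open>b = n - 1\<close>, so \<open>g\<close> is constant (lemma \<open>symmetric_recurrence_constant\<close>), and \<open>g(1) = x\<^sup>n\<close> by
    definition.

  Characteristic \<open>0\<close> enters through the cancellation of nonzero integer factors.
\<close>

section \<open>Polarisation of cubic and quartic identities\<close>

locale char0_vector_space = vector_space scale
  for scale :: "'k::field_char_0 \<Rightarrow> 'a::ab_group_add \<Rightarrow> 'a"
begin

lemma scale_of_nat_cancel: "scale (of_nat k) v = 0 \<Longrightarrow> k \<noteq> 0 \<Longrightarrow> v = 0"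
  by simp

lemma scale_2: "scale 2 v = v + v"
  using scale_left_distrib[of 1 1 v] by simp

lemma scale_3: "scale 3 v = v + v + v"
  using scale_left_distrib[of 2 1 v] by (simp add: scale_2)

lemma scale_4: "scale 4 v = v + v + v + v"
  using scale_left_distrib[of 3 1 v] by (simp add: scale_3)

lemma scale_8: "scale 8 v = v + v + v + v + v + v + v + v"
  using scale_left_distrib[of 4 4 v] by (simp add: scale_4 algebra_simps)

lemma double_eq_0: "(v :: 'a) + v = 0 \<Longrightarrow> v = 0"
  using scale_of_nat_cancel[of 2 v] by (simp add: scale_2)

lemma triple_eq_0: "(v :: 'a) + v + v = 0 \<Longrightarrow> v = 0"
  using scale_of_nat_cancel[of 3 v] by (simp add: scale_3)

text \<open>
  Instead of expanding the identity at a sum of all the variables at once, each degree reduces to the previous one: expanding at \<open>x + w\<close> isolates the part of degree one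
  in \<open>w\<close>, and that part is again an identity in \<open>x\<close>, of one degree less.
\<close>

lemma polarise2:
  fixes B :: "'b::ab_group_add \<Rightarrow> 'b \<Rightarrow> 'a"
  assumes "\<And>y. additive (\<lambda>x. B x y)" "\<And>x. additive (B x)"
    and zero: "\<And>x. B x x = 0"
  shows "B x y + B y x = 0"
  using zero[of "x + y"] zero[of x] zero[of y]
  by (simp add: assms(1,2)[THEN additive.add] algebra_simps)

lemma polarise3:
  fixes T :: "'b::ab_group_add \<Rightarrow> 'b \<Rightarrow> 'b \<Rightarrow> 'a"
  assumes add: "\<And>y z. additive (\<lambda>x. T x y z)" "\<And>x z. additive (\<lambda>y. T x y z)"
      "\<And>x y. additive (\<lambda>z. T x y z)"
    and zero: "\<And>x. T x x x = 0"
  shows "T x y z + T x z y + T y x z + T y z x + T z x y + T z y x = 0"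
proof -
  note lin = add[THEN additive.add] add[THEN additive.diff]
  define S where "S = (\<lambda>x y z. T x y z + T x z y + T z x y)"
  (* The part of degree (2,1) vanishes: changing the sign of x separates it from degree (1,2). *)
  have S0: "S x x z = 0" for x z
  proof -
    have "S x x z + S z z x = 0"
      using zero[of "x + z"] zero[of x] zero[of z] by (simp add: S_def lin algebra_simps)
    moreover have "S x x z - S z z x = 0"
      using zero[of "z - x"] zero[of x] zero[of z] by (simp add: S_def lin algebra_simps)
    ultimately have "S x x z + S x x z = 0"
      by (metis add_0 diff_add_cancel eq_iff_diff_eq_0)
    then show ?thesis by (rule double_eq_0)
  qed
  have "S x y z + S y x z = 0"
  proof (rule polarise2[of "\<lambda>x y. S x y z"])
  qed (use S0 in \<open>auto simp: S_def lin additive_def algebra_simps\<close>)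
  then show ?thesis by (simp add: S_def algebra_simps)
qed

lemma polarise4:
  fixes Q :: "'b::ab_group_add \<Rightarrow> 'b \<Rightarrow> 'b \<Rightarrow> 'b \<Rightarrow> 'a"
  assumes add: "\<And>y z w. additive (\<lambda>x. Q x y z w)" "\<And>x z w. additive (\<lambda>y. Q x y z w)"
      "\<And>x y w. additive (\<lambda>z. Q x y z w)" "\<And>x y z. additive (\<lambda>w. Q x y z w)"
    and zero: "\<And>x. Q x x x x = 0"
  defines "S \<equiv> \<lambda>x y z w. Q x y z w + Q x y w z + Q x w y z + Q w x y z"
  shows "S x y z w + S x z y w + S y x z w + S y z x w + S z x y w + S z y x w = 0"
proof -
  note lin = add[THEN additive.add] add[THEN additive.diff]
  (* The sign of x isolates the part M of degree (2,2). Replacing w by 2w scales the parts of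
     degree (3,1), (2,2) and (1,3) by 2, 4 and 8, which separates the first from the last. *)
  have S0: "S x x x w = 0" for x w
  proof -
    define M where
      "M = Q x x w w + Q x w x w + Q w x x w + Q x w w x + Q w x w x + Q w w x x"
    have plus: "S x x x w + M + S w w w x = 0"
      using zero[of "x + w"] zero[of x] zero[of w] by (simp add: S_def M_def lin algebra_simps)
    have minus: "S x x x w - M + S w w w x = 0"
      using zero[of "w - x"] zero[of x] zero[of w]
      by (simp add: S_def M_def lin algebra_simps)
    have "M + M = 0"
      using plus minus by (metis add.assoc add.commute add_diff_cancel_right' diff_add_eq diff_self)
    then have M0: "M = 0" by (rule double_eq_0)
    have plus2: "(S x x x w + S x x x w) + (M + M + M + M) + (S w w w x + S w w w x + S w w w x
        + S w w w x + S w w w x + S w w w x + S w w w x + S w w w x) = 0"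
      using zero[of "x + (w + w)"] zero[of x] zero[of w]
      by (simp add: S_def M_def lin algebra_simps)
    have "S x x x w = - S w w w x" using plus M0 by (simp add: eq_neg_iff_add_eq_0)
    then have "(S w w w x + S w w w x + S w w w x) + (S w w w x + S w w w x + S w w w x) = 0"
      using plus2 M0 by (simp add: algebra_simps)
    then have "S w w w x = 0" using double_eq_0 triple_eq_0 by blast
    then show ?thesis using plus M0 by simp
  qed
  show ?thesis
  proof (rule polarise3[of "\<lambda>x y z. S x y z w"])
  qed (use S0 in \<open>auto simp: S_def lin additive_def algebra_simps\<close>)
qed

section \<open>Linear relations among the products of a fixed degree\<close>

text \<open>
  The argument \<open>a\<close> is the exponent of one factor of a product of degree \<open>n\<close>, and \<open>f a\<close> is the
  commutator of the two factors. The hypotheses force \<open>f\<close> to be additive below \<open>n\<close>, whereas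
  antisymmetry says that the natural extension of \<open>f\<close> to \<open>n\<close> is zero.
\<close>

lemma cyclic_relation_antisymmetric_0:
  fixes f :: "nat \<Rightarrow> 'a"
  assumes antisym: "\<And>a. 1 \<le> a \<Longrightarrow> a < n \<Longrightarrow> f (n - a) = - f a"
    and cyc: "\<And>a b c. 1 \<le> a \<Longrightarrow> 1 \<le> b \<Longrightarrow> 1 \<le> c \<Longrightarrow> a + b + c = n \<Longrightarrow> f a + f b + f c = 0"
    and a: "1 \<le> a" "a < n"
  shows "f a = 0"
proof -
  have mult: "f b = scale (of_nat b) (f 1)" if "1 \<le> b" "b < n" for b
    using that
  proof (induction b rule: dec_induct)
    case base
    show ?case by simp
  next
    case (step b)
    have "f b + f 1 + f (n - Suc b) = 0"
      using step by (intro cyc) auto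
    then have "f (Suc b) = f 1 + f b"
      using antisym[of "Suc b"] step by (simp add: algebra_simps)
    then show ?case using step by (simp add: scale_left_distrib)
  qed
  have "scale (of_nat n) (f 1) = f 1 + f (n - 1)"
    using mult[of "n - 1"] scale_left_distrib[of 1 "of_nat (n - 1)" "f 1"] a
    by (simp add: of_nat_diff)
  also have "\<dots> = 0" using antisym[of 1] a by simp
  finally have "f 1 = 0" using a scale_of_nat_cancel[of n "f 1"] by simp
  then show ?thesis using mult[OF a] by simp
qed

text \<open>
  Put \<open>h(b) = g(b) - g(1)\<close>. By symmetry, \<open>g(c) = g(b + 2)\<close> and \<open>g(c + 1) = g(b + 1)\<close>, so the relation is the
  recurrence \<open>3 h(b + 2) = 8 h(b + 1) - 3 h(b) + 4 h(2)\<close>. Its solution with \<open>h(1) = 0\<close> is \<open>h(b) = c(b) h(2)\<close>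
  with \<open>c(1) = 0\<close> and \<open>c\<close> increasing, and \<open>h(n - 1) = h(1) = 0\<close> then gives \<open>h(2) = 0\<close>.
\<close>

lemma symmetric_recurrence_constant:
  fixes g :: "nat \<Rightarrow> 'a"
  assumes sym: "\<And>a. 1 \<le> a \<Longrightarrow> a < n \<Longrightarrow> g (n - a) = g a"
    and rec: "\<And>b c. 1 \<le> b \<Longrightarrow> 1 \<le> c \<Longrightarrow> b + c + 2 = n \<Longrightarrow>
      scale 3 (g 1 + g 1 + g b + g c) = scale 4 (g 2 + g (b + 1) + g (c + 1))"
    and a: "1 \<le> a" "a < n"
  shows "g a = g 1"
proof -
  define h where "h a = g a - g 1" for a
  have h1: "h 1 = 0" by (simp add: h_def)
  have hrec: "scale 3 (h (b + 2)) = scale 8 (h (b + 1)) - scale 3 (h b) + scale 4 (h 2)"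
    if "1 \<le> b" "b + 3 \<le> n" for b
  proof -
    have c: "n - (b + 2) + 1 = n - (b + 1)" using that by simp
    have "scale 3 (g 1 + g 1 + g b + g (n - (b + 2)))
        = scale 4 (g 2 + g (b + 1) + g (n - (b + 2) + 1))"
      using that by (intro rec) auto
    then have "scale 3 (g 1 + g 1 + g b + g (b + 2)) = scale 4 (g 2 + g (b + 1) + g (b + 1))"
      unfolding c using sym[of "b + 1"] sym[of "b + 2"] that by simp
    then show ?thesis
      by (simp add: h_def scale_3 scale_4 scale_8 algebra_simps)
  qed
  (* Clearing denominators, p/k and q/k are the coefficients c(b) and c(b + 1); that p <= q is
     what keeps the next coefficient (8q - 3p + 4k) / 3k at least q/k. *)
  have mult: "\<exists>k p q :: int. k > 0 \<and> q > 0 \<and> 0 \<le> p \<and> p \<le> q \<and>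
      scale (of_int k) (h b) = scale (of_int p) (h 2) \<and>
      scale (of_int k) (h (b + 1)) = scale (of_int q) (h 2)"
    if "1 \<le> b" "b + 2 \<le> n" for b
    using that
  proof (induction b rule: dec_induct)
    case base
    show ?case by (rule exI[of _ 1], rule exI[of _ 0], rule exI[of _ 1])
      (use h1 in \<open>simp add: numeral_2_eq_2[symmetric]\<close>)
  next
    case (step b)
    then obtain k p q :: int where kpq: "k > 0" "q > 0" "0 \<le> p" "p \<le> q"
      "scale (of_int k) (h b) = scale (of_int p) (h 2)"
      "scale (of_int k) (h (b + 1)) = scale (of_int q) (h 2)" by auto
    have "scale (of_int (3 * k)) (h (b + 2)) = scale (of_int k) (scale 3 (h (b + 2)))"
      by (simp add: mult.commute)
    also have "\<dots> = scale 8 (scale (of_int k) (h (b + 1))) - scale 3 (scale (of_int k) (h b))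
        + scale (of_int k) (scale 4 (h 2))"
      using hrec[of b] step
      by (simp add: scale_right_distrib scale_right_diff_distrib mult.commute)
    also have "\<dots> = scale (of_int (8 * q - 3 * p + 4 * k)) (h 2)"
      by (simp only: kpq(5,6)) (simp add: scale_left_distrib scale_left_diff_distrib mult.commute)
    finally have "scale (of_int (3 * k)) (h (b + 2)) = scale (of_int (8 * q - 3 * p + 4 * k)) (h 2)" .
    moreover have "scale (of_int (3 * k)) (h (b + 1)) = scale (of_int (3 * q)) (h 2)"
      using arg_cong[OF kpq(6), of "scale 3"] by simp
    ultimately show ?case using kpq(1-4)
      by (intro exI[of _ "3 * k"] exI[of _ "3 * q"] exI[of _ "8 * q - 3 * p + 4 * k"]) auto
  qed
  have h2: "h 2 = 0" if "3 \<le> n"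
  proof -
    have n: "n - 2 + 1 = n - 1" using that by simp
    have "1 \<le> n - 2" "n - 2 + 2 \<le> n" using that by auto
    from mult[OF this] obtain k q :: int
      where "q > 0" "scale (of_int k) (h (n - 2 + 1)) = scale (of_int q) (h 2)" by blast
    moreover have "h (n - 1) = 0" using sym[of 1] that by (simp add: h_def)
    ultimately show ?thesis unfolding n by simp
  qed
  have "h a = 0"
  proof (cases "n \<le> a + 1")
    case True
    then have "n - 1 = a" using a by simp
    then show ?thesis using sym[of 1] a by (simp add: h_def)
  next
    case False
    then obtain k p :: int where "k > 0" "scale (of_int k) (h a) = scale (of_int p) (h 2)"
      using mult[of a] a by auto
    then show ?thesis using h2 a False by simp
  qed
  then show ?thesis by (simp add: h_def)
qed

end

section \<open>Twisted products of Hom-powers\<close>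

locale char0_multiplicative_hom_algebra =
  char0_vector_space scale + multiplicative_hom_algebra scale \<mu> \<alpha>
  for scale :: "'k::field_char_0 \<Rightarrow> 'a::ab_group_add \<Rightarrow> 'a"
    and \<mu> :: "'a \<Rightarrow> 'a \<Rightarrow> 'a" and \<alpha> :: "'a \<Rightarrow> 'a"
begin

lemmas hom_algebra_add =
  linear_mult_left[THEN Vector_Spaces.linear.axioms(3), THEN module_hom.add]
  linear_mult_right[THEN Vector_Spaces.linear.axioms(3), THEN module_hom.add]
  linear_twist[THEN Vector_Spaces.linear.axioms(3), THEN module_hom.add]

lemma twist_pow_mult: "(\<alpha> ^^ m) (\<mu> x y) = \<mu> ((\<alpha> ^^ m) x) ((\<alpha> ^^ m) y)"
  by (induction m) (auto simp: twist_mult)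

lemma twist_pow_twist_pow: "(\<alpha> ^^ i) ((\<alpha> ^^ j) x) = (\<alpha> ^^ (i + j)) x"
  by (simp add: funpow_add)

lemma cubic_identity_polarised:
  assumes "\<And>x. \<mu> (\<mu> x x) (\<alpha> x) = \<mu> (\<alpha> x) (\<mu> x x)"
  shows "\<mu> (\<mu> x y + \<mu> y x) (\<alpha> z) + \<mu> (\<mu> y z + \<mu> z y) (\<alpha> x) + \<mu> (\<mu> z x + \<mu> x z) (\<alpha> y)
    = \<mu> (\<alpha> z) (\<mu> x y + \<mu> y x) + \<mu> (\<alpha> x) (\<mu> y z + \<mu> z y) + \<mu> (\<alpha> y) (\<mu> z x + \<mu> x z)"
proof -
  define T where "T = (\<lambda>x y z. \<mu> (\<mu> x y) (\<alpha> z) - \<mu> (\<alpha> z) (\<mu> x y))"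
  have "T x y z + T x z y + T y x z + T y z x + T z x y + T z y x = 0"
    by (rule polarise3) (auto simp: T_def assms additive_def hom_algebra_add)
  then show ?thesis by (simp add: T_def hom_algebra_add algebra_simps)
qed

text \<open>
  \<open>S\<close> sums over the four positions of \<open>w\<close> and \<open>P\<close> over the six orders of the other three arguments,
  so \<open>P L\<close> and \<open>P R\<close> are the two sides of the identity, symmetrised over all 24 permutations.
\<close>

lemma quartic_identity_polarised:
  assumes "\<And>x. \<mu> (\<mu> (\<mu> x x) (\<alpha> x)) (\<alpha> (\<alpha> x)) = \<mu> (\<alpha> (\<mu> x x)) (\<alpha> (\<mu> x x))"
  defines "L \<equiv> \<lambda>x y z w. \<mu> (\<mu> (\<mu> x y) (\<alpha> z)) (\<alpha> (\<alpha> w))"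
    and "R \<equiv> \<lambda>x y z w. \<mu> (\<alpha> (\<mu> x y)) (\<alpha> (\<mu> z w))"
  defines "S \<equiv> \<lambda>F x y z w. F x y z w + F x y w z + F x w y z + F w x y (z::'a) :: 'a"
  defines "P \<equiv> \<lambda>F x y z w. S F x y z w + S F x z y w + S F y x z w + S F y z x w + S F z x y w + S F z y x w"
  shows "P L x y z w = P R x y z w"
proof -
  define Q where "Q = (\<lambda>x y z w. L x y z w - R x y z w)"
  have "P Q x y z w = 0"
    unfolding P_def S_def
    by (rule polarise4) (auto simp: Q_def L_def R_def assms(1) additive_def hom_algebra_add)
  then show ?thesis by (simp add: P_def S_def Q_def algebra_simps)
qed

abbreviation pow :: "'a \<Rightarrow> nat \<Rightarrow> 'a" where
  "pow \<equiv> hom_pow \<mu> \<alpha>"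

definition twisted_prod :: "'a \<Rightarrow> nat \<Rightarrow> nat \<Rightarrow> 'a" where
  "twisted_prod x a b = \<mu> ((\<alpha> ^^ (b - 1)) (pow x a)) ((\<alpha> ^^ (a - 1)) (pow x b))"

lemma nth_hom_power_assoc_iff:
  "nth_hom_power_assoc \<mu> \<alpha> n \<longleftrightarrow> (\<forall>x. \<forall>a\<in>{1..<n}. twisted_prod x a (n - a) = pow x n)"
proof -
  have "{1..n - 1} = {1..<n}" by auto
  then have "nth_hom_power_assoc \<mu> \<alpha> n \<longleftrightarrow> (\<forall>x. \<forall>a\<in>{1..<n}. pow x n = twisted_prod x a (n - a))"
    by (simp add: nth_hom_power_assoc_def twisted_prod_def)
  then show ?thesis by metis
qed

lemma nth_hom_power_assocD:
  "nth_hom_power_assoc \<mu> \<alpha> n \<Longrightarrow> 1 \<le> a \<Longrightarrow> a < n \<Longrightarrow> twisted_prod x a (n - a) = pow x n"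
  by (simp add: nth_hom_power_assoc_iff)

lemma twisted_prod_1: "1 \<le> a \<Longrightarrow> twisted_prod x a 1 = pow x (Suc a)"
  by (cases a) (auto simp: twisted_prod_def)

section \<open>Albert's induction\<close>

text \<open>
  Powers of \<open>x\<close> have to be twisted before they are put into the polarised identities, by an amount
  that depends on their exponent and on the degree \<open>n\<close>. The right choice is
  \<open>lev r a = \<alpha>\<^bsup>n-a-r\<^esup>(x\<^sup>a)\<close>: both multiplication and \<open>\<alpha>\<close> lower the level \<open>r\<close> by one, and a product of two
  powers at level one with total exponent \<open>n\<close> is a twisted product of degree \<open>n\<close>. So the arguments
  of the cubic identity are taken at level two and those of the quartic identity at level three.
\<close>

lemma pow_assoc_step:
  assumes cubic: "\<And>x. \<mu> (\<mu> x x) (\<alpha> x) = \<mu> (\<alpha> x) (\<mu> x x)"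
    and quartic: "\<And>x. \<mu> (\<mu> (\<mu> x x) (\<alpha> x)) (\<alpha> (\<alpha> x)) = \<mu> (\<alpha> (\<mu> x x)) (\<alpha> (\<mu> x x))"
    and IH: "\<And>a b. 1 \<le> a \<Longrightarrow> 1 \<le> b \<Longrightarrow> a + b < n \<Longrightarrow> twisted_prod x a b = pow x (a + b)"
    and a: "1 \<le> a" "a < n"
  shows "twisted_prod x (n - a) a = pow x n"
proof -
  define lev where "lev r a = (\<alpha> ^^ (n - a - r)) (pow x a)" for r a
  have lev_mult: "\<mu> (lev (Suc r) a) (lev (Suc r) b) = lev r (a + b)"
    if "1 \<le> a" "1 \<le> b" "1 \<le> r" "a + b + r \<le> n" for r a b
  proof -
    have "n - a - Suc r = (n - (a + b) - r) + (b - 1)" "n - b - Suc r = (n - (a + b) - r) + (a - 1)"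
      using that by auto
    then have "\<mu> (lev (Suc r) a) (lev (Suc r) b) = (\<alpha> ^^ (n - (a + b) - r)) (twisted_prod x a b)"
      by (simp only: lev_def twisted_prod_def twist_pow_mult twist_pow_twist_pow)
    then show ?thesis using IH that by (simp add: lev_def)
  qed
  have lev_twist: "\<alpha> (lev (Suc r) a) = lev r a" if "a + r < n" for r a
  proof -
    have "n - a - r = Suc (n - a - Suc r)" using that by simp
    then show ?thesis by (simp add: lev_def)
  qed
  have lev_top: "\<mu> (lev (Suc 0) a) (lev (Suc 0) b) = twisted_prod x a b" if "a + b = n" for a b
    using that by (auto simp: lev_def twisted_prod_def)
  have comm: "twisted_prod x (n - b) b = twisted_prod x b (n - b)" if b: "1 \<le> b" "b < n" for b
  proof -
    define f where "f b = twisted_prod x (n - b) b - twisted_prod x b (n - b)" for b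
    have "f b = 0"
    proof (rule cyclic_relation_antisymmetric_0[OF _ _ b])
      fix a b c :: nat
      assume abc: "1 \<le> a" "1 \<le> b" "1 \<le> c" "a + b + c = n"
      then have "n - a = b + c" "n - b = c + a" "n - c = a + b" by auto
      then have f: "f a = twisted_prod x (b + c) a - twisted_prod x a (b + c)"
        "f b = twisted_prod x (c + a) b - twisted_prod x b (c + a)"
        "f c = twisted_prod x (a + b) c - twisted_prod x c (a + b)"
        by (simp_all add: f_def)
      define l where "l = lev (Suc (Suc 0))"
      have "\<mu> (\<mu> (l i) (l j)) (\<alpha> (l k)) = twisted_prod x (i + j) k"
        "\<mu> (\<alpha> (l k)) (\<mu> (l i) (l j)) = twisted_prod x k (i + j)"
        if "1 \<le> i" "1 \<le> j" "1 \<le> k" "i + j + k = n" for i j k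
        using that by (auto simp: l_def lev_mult lev_twist lev_top)
      then have "(f a + f b + f c) + (f a + f b + f c) = 0"
        using cubic_identity_polarised[OF cubic, of "l a" "l b" "l c"] abc unfolding f
        by (simp add: hom_algebra_add algebra_simps)
      then show "f a + f b + f c = 0" by (rule double_eq_0)
    qed (auto simp: f_def)
    then show ?thesis by (simp add: f_def)
  qed
  define g where "g b = twisted_prod x (n - b) b" for b
  have g_sym: "g (n - b) = g b" if "1 \<le> b" "b < n" for b
    using comm[OF that] that by (simp add: g_def)
  have "g a = g 1"
  proof (rule symmetric_recurrence_constant[where g = g and n = n])
    fix b c :: nat
    assume bc: "1 \<le> b" "1 \<le> c" "b + c + 2 = n"
    define l where "l = lev (Suc (Suc (Suc 0)))"
    have left: "\<mu> (\<mu> (\<mu> (l i) (l j)) (\<alpha> (l k))) (\<alpha> (\<alpha> (l m))) = g m"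
      if "1 \<le> i" "1 \<le> j" "1 \<le> k" "1 \<le> m" "i + j + k + m = n" for i j k m
    proof -
      have "\<mu> (\<mu> (\<mu> (l i) (l j)) (\<alpha> (l k))) (\<alpha> (\<alpha> (l m))) = twisted_prod x (i + j + k) m"
        using that by (simp add: l_def lev_mult lev_twist lev_top)
      moreover have "n - m = i + j + k" using that by simp
      ultimately show ?thesis by (simp only: g_def)
    qed
    (* Here g records the left factor, which commutativity in degree n permits. *)
    have right: "\<mu> (\<alpha> (\<mu> (l i) (l j))) (\<alpha> (\<mu> (l k) (l m))) = g (i + j)"
      if "1 \<le> i" "1 \<le> j" "1 \<le> k" "1 \<le> m" "i + j + k + m = n" for i j k m
    proof -
      have "\<mu> (\<alpha> (\<mu> (l i) (l j))) (\<alpha> (\<mu> (l k) (l m))) = twisted_prod x (i + j) (k + m)"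
        using that by (simp add: l_def lev_mult lev_twist lev_top)
      also have "k + m = n - (i + j)" using that by simp
      also have "twisted_prod x (i + j) \<dots> = g (i + j)"
        using that by (simp add: g_def comm)
      finally show ?thesis .
    qed
    have "n - 2 = b + c" using bc by auto
    then have g2: "g (b + c) = g 2"
      using g_sym[of 2] bc by simp
    define V where "V = scale 3 (g 1 + g 1 + g b + g c) - scale 4 (g 2 + g (b + 1) + g (c + 1))"
    (* The 24 permutations give 6 times the left hand side pattern and 8 times the right hand one,
       that is, twice V. *)
    have "V + V = 0"
      using quartic_identity_polarised[OF quartic, of "l 1" "l 1" "l b" "l c"] bc
      by (simp add: left right g2 V_def scale_3 scale_4 numeral_2_eq_2 add.commute[of c b] algebra_simps)
    then have "V = 0" by (rule double_eq_0)
    then show "scale 3 (g 1 + g 1 + g b + g c) = scale 4 (g 2 + g (b + 1) + g (c + 1))"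
      by (simp add: V_def)
  qed (use g_sym a in auto)
  also have "g 1 = pow x n" using twisted_prod_1[of "n - 1" x] a by (simp add: g_def)
  finally show ?thesis by (simp add: g_def)
qed

theorem hom_power_associative_from_degrees_3_4:
  assumes "\<And>x. \<mu> (\<mu> x x) (\<alpha> x) = \<mu> (\<alpha> x) (\<mu> x x)"
    and "\<And>x. \<mu> (\<mu> (\<mu> x x) (\<alpha> x)) (\<alpha> (\<alpha> x)) = \<mu> (\<alpha> (\<mu> x x)) (\<alpha> (\<mu> x x))"
  shows "hom_power_assoc \<mu> \<alpha>"
proof -
  have "twisted_prod x a b = pow x (a + b)" if "1 \<le> a" "1 \<le> b" for x a b
    using that
  proof (induction "a + b" arbitrary: a b rule: less_induct)
    case less
    then have "twisted_prod x (a + b - b) b = pow x (a + b)"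
      by (intro pow_assoc_step assms) auto
    then show ?case by simp
  qed
  then show ?thesis
    by (auto simp: hom_power_assoc_def nth_hom_power_assoc_iff)
qed

end

theorem corollary5p2:
  fixes scale :: "'k::field_char_0 \<Rightarrow> 'a::ab_group_add \<Rightarrow> 'a"
    and \<mu> :: "'a \<Rightarrow> 'a \<Rightarrow> 'a" and \<alpha> :: "'a \<Rightarrow> 'a"
  assumes "multiplicative_hom_algebra scale \<mu> \<alpha>"
  defines "cond1 \<equiv> (\<forall>x. \<mu> (hom_pow \<mu> \<alpha> x 2) (\<alpha> x) = \<mu> (\<alpha> x) (hom_pow \<mu> \<alpha> x 2)) \<and>
      (\<forall>x. hom_pow \<mu> \<alpha> x 4 = \<mu> (\<alpha> (hom_pow \<mu> \<alpha> x 2)) (\<alpha> (hom_pow \<mu> \<alpha> x 2)))"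
    and "cond2 \<equiv> (\<forall>x. hom_associator \<mu> \<alpha> x x x = 0 \<and>
      0 = hom_associator \<mu> \<alpha> (hom_pow \<mu> \<alpha> x 2) (\<alpha> x) (\<alpha> x))"
    and "cond3 \<equiv> up_to_nth_hom_power_assoc \<mu> \<alpha> 4"
    and "cond4 \<equiv> hom_power_assoc \<mu> \<alpha>"
  shows "(cond1 \<longleftrightarrow> cond2) \<and> (cond2 \<longleftrightarrow> cond3) \<and> (cond3 \<longleftrightarrow> cond4)"
proof -
  interpret multiplicative_hom_algebra scale \<mu> \<alpha> by fact
  interpret char0_multiplicative_hom_algebra scale \<mu> \<alpha> by unfold_locales
  have pow2: "pow x 2 = \<mu> x x" and pow3: "pow x 3 = \<mu> (\<mu> x x) (\<alpha> x)"
    and pow4: "pow x 4 = \<mu> (\<mu> (\<mu> x x) (\<alpha> x)) (\<alpha> (\<alpha> x))" for x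
    by (simp_all add: numeral_eq_Suc)
  have "cond1 \<longleftrightarrow> cond2"
    by (auto simp: cond1_def cond2_def hom_associator_def pow2 pow4 twist_mult)
  moreover have "cond1 \<Longrightarrow> cond4"
    unfolding cond1_def cond4_def pow2 pow4 by (intro hom_power_associative_from_degrees_3_4) auto
  moreover have "cond4 \<Longrightarrow> cond3"
    by (simp add: cond3_def cond4_def hom_power_assoc_def up_to_nth_hom_power_assoc_def)
  moreover have "cond3 \<Longrightarrow> cond1"
  proof -
    assume "cond3"
    then have "nth_hom_power_assoc \<mu> \<alpha> 3" "nth_hom_power_assoc \<mu> \<alpha> 4"
      by (auto simp: cond3_def up_to_nth_hom_power_assoc_def)
    note assoc = this[THEN nth_hom_power_assocD]
    have "\<mu> (pow x 2) (\<alpha> x) = \<mu> (\<alpha> x) (pow x 2)" for x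
      using assoc(1)[of 1 x] by (simp add: twisted_prod_def pow2 pow3)
    moreover have "pow x 4 = \<mu> (\<alpha> (pow x 2)) (\<alpha> (pow x 2))" for x
      using assoc(2)[of 2 x] by (simp add: twisted_prod_def)
    ultimately show cond1
      unfolding cond1_def by (intro conjI allI)
  qed
  ultimately show ?thesis by metis
qed

end
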